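(* Let $\beta_{\mathrm{pl}},\beta_{\mathrm{op}}\in\mathbb{R}$. The contraction mapping $\mathcal{B}$ associated with the two-player soft stochastic game exhibits a unique fixed point, i.e. there is exactly one free energy vector $\mathcal{V}^\star:\mathcal{S}\to\mathbb{R}$ such that $\mathcal{B}\mathcal{V}^\star=\mathcal{V}^\star$.
   Context: Two-player stochastic game: $\mathcal{S}$ is a finite nonempty state space, $\mathcal{A}$ a finite nonempty action set used by both the player (pl) and the opponent (op), $\mathcal{R}_{\mathcal{G}}:\mathcal{S}\times\mathcal{A}\times\mathcal{A}\to\mathbb{R}$ the reward function, $\mathcal{T}_{\mathcal{G}}(\cdot\,|\,\bm s,\bm a^{\mathrm{pl}},\bm a^{\mathrm{op}})$ a probability distribution on $\mathcal{S}$ for each $(\bm s,\bm a^{\mathrm{pl}},\bm a^{\mathrm{op}})$, and $\gamma\in[0,1)$ the discount factor. A policy $\pi$ assigns to each $\bm s\in\mathcal{S}$ a probability distribution $\pi(\cdot|\bm s)$ on $\mathcal{A}$; $\pi_{\mathrm{pl}}$ and $\pi_{\mathrm{op}}$ denote policies of the player and the opponent. The reference policies $\rho_{\mathrm{pl}},\rho_{\mathrm{op}}$ are uniform on $\mathcal{A}$ in every state. A free energy vector is any function $\mathcal{V}:\mathcal{S}\to\mathbb{R}$. The free energy operator is $$f(\pi_{\mathrm{pl}},\pi_{\mathrm{op}},\bm s,\mathcal V)=\mathbb{E}\Big[\mathcal{R}_{\mathcal{G}}(\bm s,\bm a^{\mathrm{pl}},\bm a^{\mathrm{op}})+\gamma\,\mathbb{E}_{\bm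 s'\sim\mathcal{T}_{\mathcal{G}}(\cdot|\bm s,\bm a^{\mathrm{pl}},\bm a^{\mathrm{op}})}[\mathcal V(\bm s')]-\tfrac{1}{\beta_{\mathrm{pl}}}\log\tfrac{\pi_{\mathrm{pl}}(\bm a^{\mathrm{pl}}|\bm s)}{\rho_{\mathrm{pl}}(\bm a^{\mathrm{pl}}|\bm s)}-\tfrac{1}{\beta_{\mathrm{op}}}\log\tfrac{\pi_{\mathrm{op}}(\bm a^{\mathrm{op}}|\bm s)}{\rho_{\mathrm{op}}(\bm a^{\mathrm{op}}|\bm s)}\Big],$$ with outer expectation over independent $\bm a^{\mathrm{pl}}\sim\pi_{\mathrm{pl}}(\cdot|\bm s)$, $\bm a^{\mathrm{op}}\sim\pi_{\mathrm{op}}(\cdot|\bm s)$ (convention $0\log 0=0$). The value $\beta=0$ for an agent is read as the limiting case in which that agent simply uses its reference policy $\rho$ (its policy is fixed to $\rho$ and its logarithmic term is $0$). The symbol $\mathrm{ext}_{\pi_{\mathrm{op}}}$ means $\max_{\pi_{\mathrm{op}}}$ if $\beta_{\mathrm{op}}>0$ and $\min_{\pi_{\mathrm{op}}}$ if $\beta_{\mathrm{op}}<0$; for the player the operation is always $\max_{\pi_{\mathrm{pl}}}$. Set $$\mathcal{B}_{\mathrm{pl}}\mathcal V(\bm s)=\max_{\pi_{\mathrm{pl}}}\,\mathrm{ext}_{\pi_{\mathrm{op}}}f(\pi_{\mathrm{pl}},\pi_{\mathrm{op}},\bm s,\mathcal V),\qquad \mathcal{B}_{\mathrm{op}}\mathcal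 V(\bm s)=\mathrm{ext}_{\pi_{\mathrm{op}}}\max_{\pi_{\mathrm{pl}}}f(\pi_{\mathrm{pl}},\pi_{\mathrm{op}},\bm s,\mathcal V).$$ The authors assert that these two operators coincide, and $\mathcal B$ denotes the common operator, $\mathcal{B}\mathcal V(\bm s):=\mathcal{B}_{\mathrm{pl}}\mathcal V(\bm s)=\mathcal{B}_{\mathrm{op}}\mathcal V(\bm s)$.
   Formalization: When both inverse temperatures are negative the max-ext and ext-max operators can differ, so the common operator B need not exist; a unique fixed point is stated for each of the two operators at all parameters, and their equality only when at least one parameter is nonnegative. *)

theory Defs
  imports "HOL-Probability.Probability"
begin

text \<open>
  States and actions range over finite types \<open>'s\<close> and \<open>'a\<close>; a policy is a function
  \<open>'s \<Rightarrow> 'a pmf\<close>.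
\<close>

definition uniform_policy :: "'s \<Rightarrow> 'a::finite pmf" where
  "uniform_policy s = pmf_of_set UNIV"

text \<open>
  The expectation only sees actions in the support, which implements \<open>0 log 0 = 0\<close>. For
  \<open>\<beta> = 0\<close> the logarithmic term vanishes because \<open>1 / 0 = 0\<close>.
\<close>

definition free_energy ::
  "('s \<Rightarrow> 'a::finite \<Rightarrow> 'a \<Rightarrow> real) \<Rightarrow> ('s \<Rightarrow> 'a \<Rightarrow> 'a \<Rightarrow> 's pmf) \<Rightarrow> real \<Rightarrow> real \<Rightarrow> real \<Rightarrow>
   ('s \<Rightarrow> 'a pmf) \<Rightarrow> ('s \<Rightarrow> 'a pmf) \<Rightarrow> 's \<Rightarrow> ('s \<Rightarrow> real) \<Rightarrow> real" where
  "free_energy R T \<gamma> \<beta>pl \<beta>op \<pi>pl \<pi>op s V =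
     measure_pmf.expectation (pair_pmf (\<pi>pl s) (\<pi>op s))
       (\<lambda>(a, b). R s a b + \<gamma> * measure_pmf.expectation (T s a b) V
          - 1 / \<beta>pl * ln (pmf (\<pi>pl s) a / pmf (uniform_policy s) a)
          - 1 / \<beta>op * ln (pmf (\<pi>op s) b / pmf (uniform_policy s) b))"

text \<open>
  \<open>GREATEST\<close> and \<open>LEAST\<close> rather than suprema and infima: the extrema are meant to be attained.
  An agent with \<open>\<beta> = 0\<close> does not optimise but plays the uniform policy. The player maximises
  for either sign of its parameter, the opponent minimises if its parameter is negative.
\<close>

definition max_pl :: "real \<Rightarrow> (('s \<Rightarrow> 'a::finite pmf) \<Rightarrow> real) \<Rightarrow> real" where
  "max_pl \<beta> g = (if \<beta> = 0 then g uniform_policy else (GREATEST x. x \<in> range g))"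

definition ext_op :: "real \<Rightarrow> (('s \<Rightarrow> 'a::finite pmf) \<Rightarrow> real) \<Rightarrow> real" where
  "ext_op \<beta> g =
     (if \<beta> = 0 then g uniform_policy
      else if \<beta> > 0 then (GREATEST x. x \<in> range g)
      else (LEAST x. x \<in> range g))"

definition bellman_pl ::
  "('s \<Rightarrow> 'a::finite \<Rightarrow> 'a \<Rightarrow> real) \<Rightarrow> ('s \<Rightarrow> 'a \<Rightarrow> 'a \<Rightarrow> 's pmf) \<Rightarrow> real \<Rightarrow> real \<Rightarrow> real \<Rightarrow>
   ('s \<Rightarrow> real) \<Rightarrow> ('s \<Rightarrow> real)" where
  "bellman_pl R T \<gamma> \<beta>pl \<beta>op V s =
     max_pl \<beta>pl (\<lambda>\<pi>pl. ext_op \<beta>op (\<lambda>\<pi>op. free_energy R T \<gamma> \<beta>pl \<beta>op \<pi>pl \<pi>op s V))"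

definition bellman_op ::
  "('s \<Rightarrow> 'a::finite \<Rightarrow> 'a \<Rightarrow> real) \<Rightarrow> ('s \<Rightarrow> 'a \<Rightarrow> 'a \<Rightarrow> 's pmf) \<Rightarrow> real \<Rightarrow> real \<Rightarrow> real \<Rightarrow>
   ('s \<Rightarrow> real) \<Rightarrow> ('s \<Rightarrow> real)" where
  "bellman_op R T \<gamma> \<beta>pl \<beta>op V s =
     ext_op \<beta>op (\<lambda>\<pi>op. max_pl \<beta>pl (\<lambda>\<pi>pl. free_energy R T \<gamma> \<beta>pl \<beta>op \<pi>pl \<pi>op s V))"

text \<open>
  The two operators are kept apart because they can differ when both parameters are negative
  (matching pennies with \<open>\<gamma> = 0\<close>): the free energy is then convex in the player's policy,
  so there is no minimax theorem. Otherwise they agree and are the operator \<open>B\<close> of the game.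
\<close>

end

theory Submission
  imports Defs "HOL-Real_Asymp.Real_Asymp"
begin

text \<open>
  A state's free energy is continuous in the two mixed actions, so over the compact simplex all
  extrema are attained; extrema are monotone and commute with adding constants, so both operators
  are \<open>\<gamma>\<close>-contractions for the sup distance and Banach's theorem applies. The order
  of the extrema is immaterial if both are maxima or if one agent does not optimise. In the
  remaining case \<open>\<beta>op < 0 < \<beta>pl\<close> the best responses are softmax policies
  (Gibbs' variational principle), so Brouwer's theorem gives mutual best responses, that is,
  a saddle point.
\<close>

section \<open>The simplex of mixed actions\<close>

text \<open>Vectors provide the Euclidean topology and the convex structure in which compactness and
  Brouwer's theorem are available.\<close>

definition pmf_vec :: "'a::finite pmf \<Rightarrow> real ^ 'a" where
  "pmf_vec p = (\<chi> a. pmf p a)"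

definition prob_simplex :: "(real ^ 'a::finite) set" where
  "prob_simplex = {x. (\<forall>a. 0 \<le> x $ a) \<and> (\<Sum>a\<in>UNIV. x $ a) = 1}"

lemma range_pmf_vec: "range pmf_vec = (prob_simplex :: (real ^ 'a::finite) set)"
proof
  show "range pmf_vec \<subseteq> (prob_simplex :: (real ^ 'a) set)"
    by (auto simp: prob_simplex_def pmf_vec_def sum_pmf_eq_1)
  show "prob_simplex \<subseteq> (range pmf_vec :: (real ^ 'a) set)"
  proof
    fix x :: "real ^ 'a" assume x: "x \<in> prob_simplex"
    have "(\<integral>\<^sup>+ a. ennreal (x $ a) \<partial>count_space UNIV) = 1"
      using x by (simp add: nn_integral_count_space_finite prob_simplex_def sum_ennreal)
    then have "pmf (embed_pmf (($) x)) a = x $ a" for a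
      using x by (intro pmf_embed_pmf) (auto simp: prob_simplex_def)
    then have "x = pmf_vec (embed_pmf (($) x))"
      by (simp add: pmf_vec_def vec_eq_iff)
    then show "x \<in> range pmf_vec" by blast
  qed
qed

lemma pmf_vec_in_prob_simplex: "pmf_vec p \<in> prob_simplex"
  using range_pmf_vec by blast

lemma prob_simplex_nonempty: "prob_simplex \<noteq> {}"
  using pmf_vec_in_prob_simplex by blast

lemma convex_prob_simplex: "convex prob_simplex"
  by (auto simp: convex_def prob_simplex_def sum.distrib simp flip: sum_distrib_left)

lemma compact_prob_simplex: "compact (prob_simplex :: (real ^ 'a::finite) set)"
proof -
  have "closed (prob_simplex :: (real ^ 'a) set)"
    unfolding prob_simplex_def
    by (intro closed_Collect_conj closed_Collect_all closed_Collect_le closed_Collect_eq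
        continuous_intros)
  moreover have "norm x \<le> 1" if "x \<in> prob_simplex" for x :: "real ^ 'a"
    using norm_le_l1_cart[of x] that by (simp add: prob_simplex_def)
  then have "bounded (prob_simplex :: (real ^ 'a) set)"
    by (auto simp: bounded_iff)
  ultimately show ?thesis by (simp add: compact_eq_bounded_closed)
qed

section \<open>Extrema over the simplex\<close>

text \<open>The sign of \<sigma> selects the operation, so one notion serves both agents. Suprema
  and infima can be estimated without naming an optimiser.\<close>

definition extremum :: "real \<Rightarrow> (real ^ 'a::finite \<Rightarrow> real) \<Rightarrow> real" where
  "extremum \<sigma> g =
     (if \<sigma> = 0 then g (pmf_vec (pmf_of_set UNIV))
      else if \<sigma> > 0 then (SUP x\<in>prob_simplex. g x)
      else (INF x\<in>prob_simplex. g x))"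

lemma prob_simplex_bdd:
  fixes g :: "real ^ 'a::finite \<Rightarrow> real"
  assumes "continuous_on prob_simplex g"
  shows "bdd_above (g ` prob_simplex)" "bdd_below (g ` prob_simplex)"
  using compact_imp_bounded[OF compact_continuous_image[OF assms compact_prob_simplex]]
  by (auto intro: bounded_imp_bdd_above bounded_imp_bdd_below)

text \<open>By compactness a maximiser \<open>z\<close> exists; its value is both the greatest
  element and the supremum.\<close>

lemma Greatest_prob_simplex:
  fixes g :: "real ^ 'a::finite \<Rightarrow> real"
  assumes "continuous_on prob_simplex g"
  shows "(GREATEST v. v \<in> g ` prob_simplex) = (SUP x\<in>prob_simplex. g x)"
proof -
  obtain z where "z \<in> prob_simplex" "\<forall>x\<in>prob_simplex. g x \<le> g z"
    using continuous_attains_sup[OF compact_prob_simplex prob_simplex_nonempty assms] by blast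
  then show ?thesis
    by (intro trans[OF Greatest_equality[of _ "g z"] cSup_eq_maximum[symmetric]]) auto
qed

lemma Least_prob_simplex:
  fixes g :: "real ^ 'a::finite \<Rightarrow> real"
  assumes "continuous_on prob_simplex g"
  shows "(LEAST v. v \<in> g ` prob_simplex) = (INF x\<in>prob_simplex. g x)"
proof -
  obtain z where "z \<in> prob_simplex" "\<forall>x\<in>prob_simplex. g z \<le> g x"
    using continuous_attains_inf[OF compact_prob_simplex prob_simplex_nonempty assms] by blast
  then show ?thesis
    by (intro trans[OF Least_equality[of _ "g z"] cInf_eq_minimum[symmetric]]) auto
qed

text \<open>Every mixed action at \<open>s\<close> comes from a constant policy, so optimising over
  policies amounts to optimising over the simplex.\<close>

lemma range_policy:
  "range (\<lambda>\<pi> :: 's \<Rightarrow> 'a::finite pmf. g (pmf_vec (\<pi> s))) = g ` prob_simplex"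
proof -
  have "surj (\<lambda>\<pi> :: 's \<Rightarrow> 'a pmf. \<pi> s)"
    by (rule surjI[of _ "\<lambda>p _. p"]) simp
  moreover have "(\<lambda>p. g (pmf_vec p)) ` range (\<lambda>\<pi> :: 's \<Rightarrow> 'a pmf. \<pi> s)
      = range (\<lambda>\<pi> :: 's \<Rightarrow> 'a pmf. g (pmf_vec (\<pi> s)))"
    by (simp only: image_image)
  ultimately show ?thesis by (simp only: image_image flip: range_pmf_vec)
qed

text \<open>The absolute value reflects that the player maximises for either sign of
  \<beta>.\<close>

lemma max_pl_eq_extremum:
  assumes "continuous_on prob_simplex g"
  shows "max_pl \<beta> (\<lambda>\<pi>. g (pmf_vec (\<pi> s))) = extremum \<bar>\<beta>\<bar> g"
  using Greatest_prob_simplex[OF assms]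
  by (simp add: max_pl_def extremum_def range_policy uniform_policy_def)

lemma ext_op_eq_extremum:
  assumes "continuous_on prob_simplex g"
  shows "ext_op \<beta> (\<lambda>\<pi>. g (pmf_vec (\<pi> s))) = extremum \<beta> g"
  using Greatest_prob_simplex[OF assms] Least_prob_simplex[OF assms]
  by (simp add: ext_op_def extremum_def range_policy uniform_policy_def)

lemma extremum_le_add:
  assumes g: "continuous_on prob_simplex g" and h: "continuous_on prob_simplex h"
    and le: "\<And>x. x \<in> prob_simplex \<Longrightarrow> g x \<le> h x + e"
  shows "extremum \<sigma> g \<le> extremum \<sigma> h + e"
proof -
  have "(SUP x\<in>prob_simplex. g x) \<le> (SUP x\<in>prob_simplex. h x) + e"
    using le cSUP_upper[OF _ prob_simplex_bdd(1)[OF h]]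
    by (intro cSUP_least prob_simplex_nonempty)
      (metis add_mono_thms_linordered_semiring(3) order_trans)
  \<comment> \<open>With \<open>e\<close> on the left, this says that a number is a lower bound of
    \<open>h\<close>, which can be checked pointwise.\<close>
  moreover have "(INF x\<in>prob_simplex. g x) - e \<le> (INF x\<in>prob_simplex. h x)"
  proof (intro cINF_greatest prob_simplex_nonempty)
    fix x :: "real ^ 'a" assume x: "x \<in> prob_simplex"
    show "(INF x\<in>prob_simplex. g x) - e \<le> h x"
      using le[OF x] cINF_lower[OF prob_simplex_bdd(2)[OF g] x] by linarith
  qed
  ultimately show ?thesis
    using le[OF pmf_vec_in_prob_simplex] by (simp add: extremum_def)
qed

lemma extremum_dist:
  assumes "continuous_on prob_simplex g" "continuous_on prob_simplex h"
    and "\<And>x. x \<in> prob_simplex \<Longrightarrow> \<bar>g x - h x\<bar> \<le> e"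
  shows "\<bar>extremum \<sigma> g - extremum \<sigma> h\<bar> \<le> e"
proof -
  have "extremum \<sigma> g \<le> extremum \<sigma> h + e" "extremum \<sigma> h \<le> extremum \<sigma> g + e"
    using assms(3) by (intro extremum_le_add assms(1,2); fastforce simp: abs_le_iff)+
  then show ?thesis by linarith
qed

section \<open>Extrema depending on a parameter, and iterated extrema\<close>

lemma continuous_on_sections:
  assumes F: "continuous_on (A \<times> B) (\<lambda>(x, y). F x y)"
  shows "x \<in> A \<Longrightarrow> continuous_on B (F x)" "y \<in> B \<Longrightarrow> continuous_on A (\<lambda>x. F x y)"
proof -
  show "continuous_on B (F x)" if "x \<in> A"
  proof -
    have "continuous_on B (Pair x)" by (intro continuous_intros)
    from continuous_on_compose2[OF F this] show ?thesis using that by auto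
  qed
  show "continuous_on A (\<lambda>x. F x y)" if "y \<in> B"
  proof -
    have "continuous_on A (\<lambda>x. (x, y))" by (intro continuous_intros)
    from continuous_on_compose2[OF F this] show ?thesis using that by auto
  qed
qed

lemma continuous_on_swap_args:
  assumes F: "continuous_on (A \<times> B) (\<lambda>(x, y). F x y)"
  shows "continuous_on (B \<times> A) (\<lambda>(y, x). F x y)"
proof -
  have "continuous_on (B \<times> A) prod.swap"
    unfolding prod.swap_def by (intro continuous_intros)
  from continuous_on_compose2[OF F this] show ?thesis by (force simp: case_prod_beta)
qed

text \<open>Uniform continuity on the compact product makes \<open>F x\<close> and
  \<open>F x'\<close> close for all \<open>y\<close> at once, and extrema are nonexpansive for the
  sup distance.\<close>

lemma continuous_on_extremum:
  fixes F :: "'b::metric_space \<Rightarrow> real ^ 'a::finite \<Rightarrow> real"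
  assumes K: "compact K" and F: "continuous_on (K \<times> prob_simplex) (\<lambda>(x, y). F x y)"
  shows "continuous_on K (\<lambda>x. extremum \<sigma> (F x))"
  unfolding continuous_on_iff
proof (intro ballI allI impI)
  fix x and e :: real assume x: "x \<in> K" and e: "0 < e"
  have "uniformly_continuous_on (K \<times> prob_simplex) (\<lambda>(x, y). F x y)"
    by (intro compact_uniformly_continuous F compact_Times K compact_prob_simplex)
  \<comment> \<open>Halving \<open>e\<close> leaves room for a strict inequality, since
    \<open>extremum_dist\<close> yields a weak one.\<close>
  then obtain d where d: "d > 0"
    and close: "\<And>p q. p \<in> K \<times> prob_simplex \<Longrightarrow> q \<in> K \<times> prob_simplex \<Longrightarrow> dist q p < d \<Longrightarrow>
      dist ((\<lambda>(x, y). F x y) q) ((\<lambda>(x, y). F x y) p) < e / 2"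
    unfolding uniformly_continuous_on_def using half_gt_zero[OF e] by metis
  have "dist (extremum \<sigma> (F x')) (extremum \<sigma> (F x)) < e" if x': "x' \<in> K" "dist x' x < d" for x'
  proof -
    have "\<bar>F x' y - F x y\<bar> \<le> e / 2" if "y \<in> prob_simplex" for y
      using close[of "(x, y)" "(x', y)"] x x' that by (simp add: dist_Pair_Pair dist_real_def)
    then have "\<bar>extremum \<sigma> (F x') - extremum \<sigma> (F x)\<bar> \<le> e / 2"
      by (intro extremum_dist continuous_on_sections(1)[OF F] x x')
    then show ?thesis using e by (simp add: dist_real_def)
  qed
  then show "\<exists>d>0. \<forall>x'\<in>K. dist x' x < d \<longrightarrow> dist (extremum \<sigma> (F x')) (extremum \<sigma> (F x)) < e"
    using d by blast
qed

text \<open>Nonexpansiveness is applied to the inner and then to the outer extremum. No exchange is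
  involved, so the signs of \<sigma> and \<tau> are arbitrary.\<close>

lemma extremum_extremum_dist:
  fixes F G :: "real ^ 'b::finite \<Rightarrow> real ^ 'a::finite \<Rightarrow> real"
  assumes F: "continuous_on (prob_simplex \<times> prob_simplex) (\<lambda>(x, y). F x y)"
    and G: "continuous_on (prob_simplex \<times> prob_simplex) (\<lambda>(x, y). G x y)"
    and dist: "\<And>x y. x \<in> prob_simplex \<Longrightarrow> y \<in> prob_simplex \<Longrightarrow> \<bar>F x y - G x y\<bar> \<le> e"
  shows "\<bar>extremum \<sigma> (\<lambda>x. extremum \<tau> (F x)) - extremum \<sigma> (\<lambda>x. extremum \<tau> (G x))\<bar> \<le> e"
proof (rule extremum_dist[OF continuous_on_extremum[OF compact_prob_simplex F]
      continuous_on_extremum[OF compact_prob_simplex G]])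
  fix x :: "real ^ 'b" assume x: "x \<in> prob_simplex"
  show "\<bar>extremum \<tau> (F x) - extremum \<tau> (G x)\<bar> \<le> e"
    by (rule extremum_dist[OF continuous_on_sections(1)[OF F x] continuous_on_sections(1)[OF G x]
          dist[OF x]])
qed

section \<open>Exchanging the extrema\<close>

text \<open>Every single value \<open>F x y\<close> lies below the iterated supremum on the right.
  The converse inequality is this one with the arguments of \<open>F\<close> swapped.\<close>

lemma SUP_SUP_le_swap:
  fixes F :: "real ^ 'b::finite \<Rightarrow> real ^ 'a::finite \<Rightarrow> real"
  assumes F: "continuous_on (prob_simplex \<times> prob_simplex) (\<lambda>(x, y). F x y)" and "\<sigma> > 0" "\<tau> > 0"
  shows "extremum \<sigma> (\<lambda>x. extremum \<tau> (F x)) \<le> extremum \<tau> (\<lambda>y. extremum \<sigma> (\<lambda>x. F x y))"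
proof -
  have "F x y \<le> (SUP y\<in>prob_simplex. SUP x\<in>prob_simplex. F x y)"
    if x: "x \<in> prob_simplex" and y: "y \<in> prob_simplex" for x y
  proof -
    \<comment> \<open>The outer supremum dominates its members only if they are bounded above;
      continuity on the compact simplex ensures this. The parameter 1 stands for any positive
      number.\<close>
    have "continuous_on prob_simplex (\<lambda>y. SUP x\<in>prob_simplex. F x y)"
      using continuous_on_extremum[OF compact_prob_simplex continuous_on_swap_args[OF F], of 1]
      by (simp add: extremum_def)
    then show ?thesis
      by (intro cSUP_upper2[OF prob_simplex_bdd(1) y] cSUP_upper x prob_simplex_bdd
          continuous_on_sections(2)[OF F] y)
  qed
  then show ?thesis
    using assms(2,3) by (auto simp: extremum_def intro!: cSUP_least prob_simplex_nonempty)
qed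

text \<open>Both iterated extrema equal \<open>F x0 y0\<close>: \<open>x0\<close> guarantees this
  value against every \<open>y\<close>, and \<open>y0\<close> prevents any \<open>x\<close> from
  exceeding it.\<close>

lemma SUP_INF_swap_saddle_point:
  fixes F :: "real ^ 'b::finite \<Rightarrow> real ^ 'a::finite \<Rightarrow> real"
  assumes F: "continuous_on (prob_simplex \<times> prob_simplex) (\<lambda>(x, y). F x y)"
    and \<sigma>: "\<sigma> > 0" and \<tau>: "\<tau> < 0"
    and x0: "x0 \<in> prob_simplex" and y0: "y0 \<in> prob_simplex"
    and max: "\<And>x. x \<in> prob_simplex \<Longrightarrow> F x y0 \<le> F x0 y0"
    and min: "\<And>y. y \<in> prob_simplex \<Longrightarrow> F x0 y0 \<le> F x0 y"
  shows "extremum \<sigma> (\<lambda>x. extremum \<tau> (F x)) = extremum \<tau> (\<lambda>y. extremum \<sigma> (\<lambda>x. F x y))"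
proof -
  have "(SUP x\<in>prob_simplex. INF y\<in>prob_simplex. F x y) = F x0 y0"
  proof (rule cSup_eq_maximum)
    show "F x0 y0 \<in> (\<lambda>x. INF y\<in>prob_simplex. F x y) ` prob_simplex"
      using x0 y0 min by (intro image_eqI[of _ _ x0] cInf_eq_minimum[symmetric]) auto
    show "v \<le> F x0 y0" if "v \<in> (\<lambda>x. INF y\<in>prob_simplex. F x y) ` prob_simplex" for v
      using that max prob_simplex_bdd(2)[OF continuous_on_sections(1)[OF F]] y0
      by (auto intro: cINF_lower2)
  qed
  moreover have "(INF y\<in>prob_simplex. SUP x\<in>prob_simplex. F x y) = F x0 y0"
  proof (rule cInf_eq_minimum)
    show "F x0 y0 \<in> (\<lambda>y. SUP x\<in>prob_simplex. F x y) ` prob_simplex"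
      using x0 y0 max by (intro image_eqI[of _ _ y0] cSup_eq_maximum[symmetric]) auto
    show "F x0 y0 \<le> v" if "v \<in> (\<lambda>y. SUP x\<in>prob_simplex. F x y) ` prob_simplex" for v
      using that min prob_simplex_bdd(1)[OF continuous_on_sections(2)[OF F]] x0
      by (auto intro: cSUP_upper2)
  qed
  ultimately show ?thesis using \<sigma> \<tau> by (simp add: extremum_def)
qed

section \<open>Gibbs' variational principle\<close>

text \<open>This is the Kullback-Leibler divergence from the uniform distribution, whose masses are
  the reciprocal of \<open>CARD('a)\<close>.\<close>

definition rel_entropy :: "real ^ 'a::finite \<Rightarrow> real" where
  "rel_entropy x = (\<Sum>a\<in>UNIV. x $ a * ln (x $ a * CARD('a)))"

definition softmax :: "('a::finite \<Rightarrow> real) \<Rightarrow> real ^ 'a" where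
  "softmax c = (\<chi> a. exp (c a) / (\<Sum>b\<in>UNIV. exp (c b)))"

lemma sum_exp_pos: "(\<Sum>b\<in>UNIV. exp (c b :: real)) > 0" for c :: "'a::finite \<Rightarrow> real"
  by (intro sum_pos) auto

lemma softmax_in_prob_simplex: "softmax c \<in> prob_simplex"
  using sum_exp_pos[of c] by (simp add: softmax_def prob_simplex_def flip: sum_divide_distrib)

text \<open>The right side minus the left side is the divergence of \<open>x\<close> from
  \<open>softmax c\<close>, which is nonnegative.\<close>

lemma gibbs_le:
  fixes c :: "'a::finite \<Rightarrow> real"
  assumes x: "x \<in> prob_simplex"
  shows "(\<Sum>a\<in>UNIV. x $ a * c a) - rel_entropy x \<le> ln (\<Sum>a\<in>UNIV. exp (c a)) - ln CARD('a)"
proof -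
  define Z where "Z = (\<Sum>a\<in>UNIV. exp (c a))"
  have Z: "Z > 0" unfolding Z_def by (rule sum_exp_pos)
  have n: "real CARD('a) > 0" by simp
  \<comment> \<open>Entrywise use of ln t \<le> t - 1. The corrections
    \<open>softmax c $ a - x $ a\<close> sum to 0 because both vectors have mass 1.\<close>
  have "x $ a * c a - x $ a * ln (x $ a * CARD('a))
      \<le> x $ a * (ln Z - ln CARD('a)) + (softmax c $ a - x $ a)" for a
  proof (cases "x $ a = 0")
    case True
    then show ?thesis using Z by (simp add: softmax_def Z_def)
  next
    case False
    then have pos: "x $ a > 0" using x by (auto simp: prob_simplex_def less_le)
    define z where "z = softmax c $ a"
    have z: "z > 0" "c a = ln z + ln Z" using Z by (auto simp: z_def softmax_def Z_def ln_div)
    have "x $ a * ln (z / x $ a) \<le> x $ a * (z / x $ a - 1)"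
      using z pos by (intro mult_left_mono ln_le_minus_one) auto
    also have "\<dots> = z - x $ a" using pos by (simp add: field_simps)
    finally have "x $ a * (ln z - ln (x $ a)) \<le> z - x $ a" using z pos by (simp add: ln_div)
    then show ?thesis
      unfolding z_def[symmetric] z(2) using pos n by (simp add: ln_mult algebra_simps)
  qed
  then have "(\<Sum>a\<in>UNIV. x $ a * c a - x $ a * ln (x $ a * CARD('a)))
      \<le> (\<Sum>a\<in>UNIV. x $ a * (ln Z - ln CARD('a)) + (softmax c $ a - x $ a))"
    by (rule sum_mono)
  then show ?thesis
    using x softmax_in_prob_simplex[of c]
    by (simp add: rel_entropy_def sum_subtractf sum.distrib prob_simplex_def
        flip: sum_distrib_right Z_def)
qed

text \<open>Since \<open>c a\<close> is \<open>ln Z\<close> plus the logarithm of the softmax entry,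
  each summand is that entry times one common constant.\<close>

lemma gibbs_eq:
  fixes c :: "'a::finite \<Rightarrow> real"
  shows "(\<Sum>a\<in>UNIV. softmax c $ a * c a) - rel_entropy (softmax c)
    = ln (\<Sum>a\<in>UNIV. exp (c a)) - ln CARD('a)"
proof -
  define Z where "Z = (\<Sum>a\<in>UNIV. exp (c a))"
  have Z: "Z > 0" unfolding Z_def by (rule sum_exp_pos)
  have "softmax c $ a * c a - softmax c $ a * ln (softmax c $ a * CARD('a))
      = softmax c $ a * (ln Z - ln CARD('a))" for a
    using Z by (simp add: softmax_def ln_mult ln_div algebra_simps flip: Z_def)
  then have "(\<Sum>a\<in>UNIV. softmax c $ a * c a) - rel_entropy (softmax c)
      = (\<Sum>a\<in>UNIV. softmax c $ a * (ln Z - ln CARD('a)))"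
    by (simp add: rel_entropy_def flip: sum_subtractf)
  then show ?thesis
    using softmax_in_prob_simplex[of c]
    by (simp add: prob_simplex_def Z_def flip: sum_distrib_right)
qed

text \<open>Multiplying by \<beta> normalises the weight of the entropy to 1 and reduces the claim
  to Gibbs' principle for \<open>\<beta> * c a\<close>.\<close>

lemma softmax_maximal:
  assumes x: "x \<in> prob_simplex" and \<beta>: "\<beta> > 0"
  shows "(\<Sum>a\<in>UNIV. x $ a * c a) - 1 / \<beta> * rel_entropy x
    \<le> (\<Sum>a\<in>UNIV. softmax (\<lambda>a. \<beta> * c a) $ a * c a) - 1 / \<beta> * rel_entropy (softmax (\<lambda>a. \<beta> * c a))"
proof -
  have scale: "(\<Sum>a\<in>UNIV. z $ a * c a) - 1 / \<beta> * rel_entropy z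
      = ((\<Sum>a\<in>UNIV. z $ a * (\<beta> * c a)) - rel_entropy z) / \<beta>" for z
    using \<beta> by (simp add: diff_divide_distrib mult.left_commute[of _ \<beta>] flip: sum_distrib_left)
  show ?thesis
    unfolding scale gibbs_eq using gibbs_le[OF x, of "\<lambda>a. \<beta> * c a"] \<beta>
    by (simp add: divide_right_mono)
qed

section \<open>The regularised payoff of a state\<close>

definition payoff ::
  "('a::finite \<Rightarrow> 'a \<Rightarrow> real) \<Rightarrow> real \<Rightarrow> real \<Rightarrow> real ^ 'a \<Rightarrow> real ^ 'a \<Rightarrow> real" where
  "payoff Q \<beta>pl \<beta>op x y =
     (\<Sum>a\<in>UNIV. \<Sum>b\<in>UNIV. x $ a * y $ b * Q a b)
       - 1 / \<beta>pl * rel_entropy x - 1 / \<beta>op * rel_entropy y"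

text \<open>Each form is linear in one agent's mixed action up to that agent's entropy term and a
  constant, the shape treated by \<open>softmax_maximal\<close>.\<close>

lemma payoff_eq:
  "payoff Q \<beta>pl \<beta>op x y =
     (\<Sum>a\<in>UNIV. x $ a * (\<Sum>b\<in>UNIV. y $ b * Q a b))
       - 1 / \<beta>pl * rel_entropy x - 1 / \<beta>op * rel_entropy y"
  "payoff Q \<beta>pl \<beta>op x y =
     (\<Sum>b\<in>UNIV. y $ b * (\<Sum>a\<in>UNIV. x $ a * Q a b))
       - 1 / \<beta>pl * rel_entropy x - 1 / \<beta>op * rel_entropy y"
  unfolding payoff_def
  by (simp add: sum_distrib_left mult.assoc)
    (subst sum.swap, simp add: sum_distrib_left mult_ac)

text \<open>The delicate point is 0, where t ln t tends to 0; splitting the logarithm leaves a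
  linear term that vanishes there too.\<close>

lemma continuous_on_mult_ln: "continuous_on {0..} (\<lambda>t::real. t * ln (t * c))"
proof (cases "c = 0")
  case False
  have "continuous (at t within {0..}) (\<lambda>t. t * ln (t * c))" if "t \<ge> 0" for t
  proof (cases "t = 0")
    case True
    have "((\<lambda>t::real. t * ln t) \<longlongrightarrow> 0) (at_right 0)" by real_asymp
    then have "((\<lambda>t::real. t * ln t + t * ln c) \<longlongrightarrow> 0 + 0 * ln c) (at_right 0)"
      by (intro tendsto_intros)
    moreover have "\<forall>\<^sub>F t in at_right 0. t * ln t + t * ln c = t * ln (t * c)"
      using False by (intro eventually_at_rightI[of 0 1]) (auto simp: ln_mult algebra_simps)
    ultimately have "((\<lambda>t::real. t * ln (t * c)) \<longlongrightarrow> 0) (at_right 0)"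
      by (auto intro: Lim_transform_eventually)
    then show ?thesis using True by (simp add: continuous_within at_within_Ici_at_right)
  next
    case t: False
    then have "isCont (\<lambda>t. t * ln (t * c)) t"
      using False by (intro continuous_intros) auto
    then show ?thesis by (rule continuous_at_imp_continuous_at_within)
  qed
  then show ?thesis by (simp add: continuous_on_eq_continuous_within)
qed simp

lemma continuous_on_rel_entropy: "continuous_on prob_simplex rel_entropy"
  unfolding rel_entropy_def
  by (intro continuous_on_sum continuous_on_compose2[OF continuous_on_mult_ln] continuous_intros)
    (auto simp: prob_simplex_def)

lemma continuous_on_payoff:
  "continuous_on (prob_simplex \<times> prob_simplex) (\<lambda>(x, y). payoff Q \<beta>pl \<beta>op x y)"
  unfolding payoff_def case_prod_beta
  by (intro continuous_intros continuous_on_compose2[OF continuous_on_rel_entropy]) auto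

text \<open>The entropy terms cancel, leaving an average of \<open>Q a b - Q' a b\<close> under the
  product distribution.\<close>

lemma payoff_dist:
  assumes x: "x \<in> prob_simplex" and y: "y \<in> prob_simplex" and e: "\<And>a b. \<bar>Q a b - Q' a b\<bar> \<le> e"
  shows "\<bar>payoff Q \<beta>pl \<beta>op x y - payoff Q' \<beta>pl \<beta>op x y\<bar> \<le> e"
proof -
  have "payoff Q \<beta>pl \<beta>op x y - payoff Q' \<beta>pl \<beta>op x y
      = (\<Sum>a\<in>UNIV. \<Sum>b\<in>UNIV. x $ a * y $ b * (Q a b - Q' a b))"
    by (simp add: payoff_def right_diff_distrib sum_subtractf)
  also have "\<bar>\<dots>\<bar> \<le> (\<Sum>a\<in>UNIV. \<Sum>b\<in>UNIV. x $ a * y $ b * e)"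
  proof (intro order_trans[OF sum_abs] sum_mono)
    fix a b
    have "0 \<le> x $ a * y $ b" using x y by (simp add: prob_simplex_def)
    then show "\<bar>x $ a * y $ b * (Q a b - Q' a b)\<bar> \<le> x $ a * y $ b * e"
      by (simp only: abs_mult[of "x $ a * y $ b"] abs_of_nonneg mult_left_mono[OF e])
  qed
  also have "\<dots> = (\<Sum>a\<in>UNIV. x $ a) * (\<Sum>b\<in>UNIV. y $ b) * e"
    by (subst sum_product) (simp only: sum_distrib_right)
  also have "\<dots> = e"
    using x y by (simp add: prob_simplex_def)
  finally show ?thesis .
qed

text \<open>With these signs the entropy is a penalty for both agents, so each best response is a
  softmax that depends continuously on the other's action.\<close>

lemma payoff_saddle_point:
  fixes Q :: "'a::finite \<Rightarrow> 'a \<Rightarrow> real"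
  assumes \<beta>pl: "\<beta>pl > 0" and \<beta>op: "\<beta>op < 0"
  obtains x0 y0 where "x0 \<in> prob_simplex" "y0 \<in> prob_simplex"
    "\<And>x. x \<in> prob_simplex \<Longrightarrow> payoff Q \<beta>pl \<beta>op x y0 \<le> payoff Q \<beta>pl \<beta>op x0 y0"
    "\<And>y. y \<in> prob_simplex \<Longrightarrow> payoff Q \<beta>pl \<beta>op x0 y0 \<le> payoff Q \<beta>pl \<beta>op x0 y"
proof -
  define bpl where "bpl y = softmax (\<lambda>a. \<beta>pl * (\<Sum>b\<in>UNIV. y $ b * Q a b))" for y :: "real ^ 'a"
  \<comment> \<open>minimising with \<open>\<beta>op\<close> is maximising the negated payoff with \<open>- \<beta>op\<close>\<close>
  define bop where "bop x = softmax (\<lambda>b. - \<beta>op * - (\<Sum>a\<in>UNIV. x $ a * Q a b))"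
    for x :: "real ^ 'a"
  have continuous: "continuous_on (prob_simplex \<times> prob_simplex) (\<lambda>(x, y). (bpl y, bop x))"
    unfolding bpl_def bop_def softmax_def case_prod_beta
    by (intro continuous_intros ballI less_imp_neq[OF sum_exp_pos, symmetric])
  have maps: "(\<lambda>(x, y). (bpl y, bop x))
      \<in> prob_simplex \<times> prob_simplex \<rightarrow> prob_simplex \<times> prob_simplex"
    by (auto simp: bpl_def bop_def softmax_in_prob_simplex)
  have nonempty: "(prob_simplex \<times> prob_simplex :: ((real ^ 'a) \<times> (real ^ 'a)) set) \<noteq> {}"
    using prob_simplex_nonempty by auto
  obtain p where p: "p \<in> prob_simplex \<times> prob_simplex" "(\<lambda>(x, y). (bpl y, bop x)) p = p"
    by (rule brouwer[OF compact_Times[OF compact_prob_simplex compact_prob_simplex]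
          convex_Times[OF convex_prob_simplex convex_prob_simplex] nonempty continuous maps])
  obtain x0 y0 where "p = (x0, y0)" by (cases p)
  with p have in_simplex: "x0 \<in> prob_simplex" "y0 \<in> prob_simplex"
    and fixed: "bpl y0 = x0" "bop x0 = y0" by auto
  show thesis
  proof (rule that[OF in_simplex])
    show "payoff Q \<beta>pl \<beta>op x y0 \<le> payoff Q \<beta>pl \<beta>op x0 y0" if "x \<in> prob_simplex" for x
      using softmax_maximal[OF that \<beta>pl, of "\<lambda>a. \<Sum>b\<in>UNIV. y0 $ b * Q a b"] fixed(1)
      by (simp add: payoff_eq(1) bpl_def)
    show "payoff Q \<beta>pl \<beta>op x0 y0 \<le> payoff Q \<beta>pl \<beta>op x0 y" if "y \<in> prob_simplex" for y
      using softmax_maximal[OF that, of "- \<beta>op" "\<lambda>b. - (\<Sum>a\<in>UNIV. x0 $ a * Q a b)"] fixed(2) \<beta>op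
      unfolding bop_def[symmetric]
      by (simp add: payoff_eq(2) sum_negf)
  qed
qed

text \<open>A zero parameter turns one extremum into evaluation at the uniform vector. Two suprema
  commute without any concavity, hence for either sign of \<beta>pl. Only
  \<open>\<beta>pl > 0\<close> with \<open>\<beta>op < 0\<close> calls for the saddle point.\<close>

lemma extremum_payoff_swap:
  assumes "0 \<le> \<beta>pl \<or> 0 \<le> \<beta>op"
  shows "extremum \<bar>\<beta>pl\<bar> (\<lambda>x. extremum \<beta>op (payoff Q \<beta>pl \<beta>op x))
    = extremum \<beta>op (\<lambda>y. extremum \<bar>\<beta>pl\<bar> (\<lambda>x. payoff Q \<beta>pl \<beta>op x y))"
proof -
  consider "\<beta>pl = 0 \<or> \<beta>op = 0" | "\<beta>pl \<noteq> 0" "\<beta>op > 0" | "\<beta>pl > 0" "\<beta>op < 0"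
    using assms by linarith
  then show ?thesis
  proof cases
    case 1
    then show ?thesis by (auto simp: extremum_def)
  next
    case 2
    then show ?thesis
      by (intro antisym SUP_SUP_le_swap continuous_on_payoff
          SUP_SUP_le_swap[OF continuous_on_swap_args[OF continuous_on_payoff]]) auto
  next
    case 3
    then obtain x0 y0 where "x0 \<in> prob_simplex" "y0 \<in> prob_simplex"
      "\<And>x. x \<in> prob_simplex \<Longrightarrow> payoff Q \<beta>pl \<beta>op x y0 \<le> payoff Q \<beta>pl \<beta>op x0 y0"
      "\<And>y. y \<in> prob_simplex \<Longrightarrow> payoff Q \<beta>pl \<beta>op x0 y0 \<le> payoff Q \<beta>pl \<beta>op x0 y"
      using payoff_saddle_point by blast
    then show ?thesis
      using 3 SUP_INF_swap_saddle_point[OF continuous_on_payoff, of "\<bar>\<beta>pl\<bar>" \<beta>op x0 y0] by simp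
  qed
qed

section \<open>The two Bellman operators\<close>

text \<open>The free energy depends on \<open>V\<close> through this matrix alone, so the factor
  \<gamma> has to be found only here.\<close>

definition action_value ::
  "('s \<Rightarrow> 'a \<Rightarrow> 'a \<Rightarrow> real) \<Rightarrow> ('s \<Rightarrow> 'a \<Rightarrow> 'a \<Rightarrow> 's pmf) \<Rightarrow> real \<Rightarrow> ('s \<Rightarrow> real) \<Rightarrow>
   's \<Rightarrow> 'a \<Rightarrow> 'a \<Rightarrow> real" where
  "action_value R T \<gamma> V s a b = R s a b + \<gamma> * measure_pmf.expectation (T s a b) V"

text \<open>Independence factorises the expectation; in each logarithmic term the other agent's
  probabilities sum to 1.\<close>

lemma free_energy_eq_payoff:
  fixes R :: "'s \<Rightarrow> 'a::finite \<Rightarrow> 'a \<Rightarrow> real"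
  shows "free_energy R T \<gamma> \<beta>pl \<beta>op \<pi>pl \<pi>op s V
    = payoff (action_value R T \<gamma> V s) \<beta>pl \<beta>op (pmf_vec (\<pi>pl s)) (pmf_vec (\<pi>op s))"
proof -
  let ?p = "pmf (\<pi>pl s)" and ?q = "pmf (\<pi>op s)" and ?n = "real CARD('a)"
  let ?k = "\<lambda>a. 1 / \<beta>pl * ln (?p a * ?n)" and ?l = "\<lambda>b. 1 / \<beta>op * ln (?q b * ?n)"
  \<comment> \<open>Dividing by the uniform mass produces the factor \<open>?n\<close>. Pairs
    outside the support have weight 0, so the sum may run over all pairs.\<close>
  have "free_energy R T \<gamma> \<beta>pl \<beta>op \<pi>pl \<pi>op s V
      = (\<Sum>(a, b)\<in>UNIV. (action_value R T \<gamma> V s a b - ?k a - ?l b) * (?p a * ?q b))"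
    unfolding free_energy_def
    by (subst integral_measure_pmf_real[of UNIV])
      (auto intro!: sum.cong simp: pmf_pair uniform_policy_def action_value_def)
  also have "\<dots> = (\<Sum>a\<in>UNIV. \<Sum>b\<in>UNIV. ?p a * ?q b * action_value R T \<gamma> V s a b
      - ?p a * ?k a * ?q b - ?p a * (?q b * ?l b))"
    by (simp add: sum.cartesian_product algebra_simps flip: UNIV_Times_UNIV)
  also have "\<dots> = (\<Sum>a\<in>UNIV. \<Sum>b\<in>UNIV. ?p a * ?q b * action_value R T \<gamma> V s a b)
      - (\<Sum>a\<in>UNIV. ?p a * ?k a) - (\<Sum>b\<in>UNIV. ?q b * ?l b)"
    by (simp only: sum_subtractf sum_pmf_eq_1[OF finite subset_UNIV]
        mult_1_right mult_1_left flip: sum_distrib_left sum_distrib_right)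
  also have "\<dots> = payoff (action_value R T \<gamma> V s) \<beta>pl \<beta>op (pmf_vec (\<pi>pl s)) (pmf_vec (\<pi>op s))"
    by (simp add: payoff_def rel_entropy_def pmf_vec_def sum_divide_distrib)
  finally show ?thesis .
qed

text \<open>The rewriting goes from the inside out: continuity of the inner extremum ensures that
  the outer one is attained.\<close>

lemma bellman_pl_eq_extremum:
  "bellman_pl R T \<gamma> \<beta>pl \<beta>op V s =
     extremum \<bar>\<beta>pl\<bar> (\<lambda>x. extremum \<beta>op (payoff (action_value R T \<gamma> V s) \<beta>pl \<beta>op x))"
  unfolding bellman_pl_def free_energy_eq_payoff
  by (simp add: ext_op_eq_extremum[OF continuous_on_sections(1)[OF continuous_on_payoff
          pmf_vec_in_prob_simplex]]
      max_pl_eq_extremum[OF continuous_on_extremum[OF compact_prob_simplex continuous_on_payoff]])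

lemma bellman_op_eq_extremum:
  "bellman_op R T \<gamma> \<beta>pl \<beta>op V s =
     extremum \<beta>op (\<lambda>y. extremum \<bar>\<beta>pl\<bar> (\<lambda>x. payoff (action_value R T \<gamma> V s) \<beta>pl \<beta>op x y))"
  unfolding bellman_op_def free_energy_eq_payoff
  by (simp add: max_pl_eq_extremum[OF continuous_on_sections(2)[OF continuous_on_payoff
          pmf_vec_in_prob_simplex]]
      ext_op_eq_extremum[OF continuous_on_extremum[OF compact_prob_simplex
          continuous_on_swap_args[OF continuous_on_payoff]]])

section \<open>Contraction and Banach's fixed point theorem\<close>

lemma action_value_dist:
  fixes V W :: "'s::finite \<Rightarrow> real"
  assumes \<gamma>: "0 \<le> \<gamma>" and e: "\<And>s. \<bar>V s - W s\<bar> \<le> e"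
  shows "\<bar>action_value R T \<gamma> V s a b - action_value R T \<gamma> W s a b\<bar> \<le> \<gamma> * e"
proof -
  have int: "integrable (measure_pmf (T s a b)) f" for f :: "'s \<Rightarrow> real"
    by (intro integrable_measure_pmf_finite) simp
  have "\<bar>measure_pmf.expectation (T s a b) (\<lambda>s. V s - W s)\<bar>
      \<le> measure_pmf.expectation (T s a b) (\<lambda>s. \<bar>V s - W s\<bar>)"
    by (rule integral_abs_bound)
  also have "\<dots> \<le> e"
    using e by (intro measure_pmf.integral_le_const int) auto
  finally have "\<bar>measure_pmf.expectation (T s a b) V - measure_pmf.expectation (T s a b) W\<bar> \<le> e"
    by (simp add: int)
  then show ?thesis
    using mult_left_mono[OF _ \<gamma>] \<gamma>
    by (simp add: action_value_def abs_mult flip: right_diff_distrib)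
qed

text \<open>Banach's theorem is applied to bounded continuous functions, whose distance is the sup
  distance. On the discrete copy of a finite type every function is one of these.\<close>

lemma sup_contraction_unique_fixed_point:
  fixes B :: "('s::finite \<Rightarrow> real) \<Rightarrow> 's \<Rightarrow> real"
  assumes \<gamma>: "0 \<le> \<gamma>" "\<gamma> < 1"
    and B: "\<And>V W e s. (\<And>s. \<bar>V s - W s\<bar> \<le> e) \<Longrightarrow> \<bar>B V s - B W s\<bar> \<le> \<gamma> * e"
  shows "\<exists>!V. B V = V"
proof -
  define vec :: "('s discrete \<Rightarrow>\<^sub>C real) \<Rightarrow> 's \<Rightarrow> real" where "vec f s = f (discrete s)" for f s
  define fn :: "('s \<Rightarrow> real) \<Rightarrow> 's discrete \<Rightarrow>\<^sub>C real" where
    "fn V = Bcontfun (\<lambda>x. V (of_discrete x))" for V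
  have bcontfun: "(\<lambda>x :: 's discrete. V (of_discrete x)) \<in> bcontfun" for V :: "'s \<Rightarrow> real"
  proof (rule bcontfun_normI)
    show "continuous_on UNIV (\<lambda>x :: 's discrete. V (of_discrete x))"
      by (simp add: continuous_on_open_vimage open_discrete)
    show "norm (V (of_discrete x)) \<le> (\<Sum>s\<in>UNIV. \<bar>V s\<bar>)" for x
      by (auto intro: member_le_sum)
  qed
  have vec_fn: "vec (fn V) = V" for V
    by (simp add: fun_eq_iff vec_def fn_def Bcontfun_inverse[OF bcontfun] discrete_inverse)
  have "dist (fn (B (vec f))) (fn (B (vec g))) \<le> \<gamma> * dist f g" for f g
  proof (rule dist_bound)
    fix x :: "'s discrete"
    have "\<bar>B (vec f) (of_discrete x) - B (vec g) (of_discrete x)\<bar> \<le> \<gamma> * dist f g"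
      using dist_bounded[of f _ g] by (intro B) (simp add: vec_def dist_real_def)
    then show "dist (fn (B (vec f)) x) (fn (B (vec g)) x) \<le> \<gamma> * dist f g"
      using vec_fn by (metis dist_real_def of_discrete_inverse vec_def)
  qed
  then have "\<exists>!f. fn (B (vec f)) = f"
    by (intro banach_fix_type[OF \<gamma>]) blast
  \<comment> \<open>As \<open>vec\<close> undoes \<open>fn\<close>, the fixed points of
    \<open>B\<close> and of its conjugate correspond: \<open>V\<close> goes to \<open>fn V\<close>
    and \<open>f\<close> to \<open>vec f\<close>.\<close>
  then show ?thesis
    by (metis vec_fn)
qed

theorem corollary1:
  fixes R :: "'s::finite \<Rightarrow> 'a::finite \<Rightarrow> 'a \<Rightarrow> real"
    and T :: "'s \<Rightarrow> 'a \<Rightarrow> 'a \<Rightarrow> 's pmf"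
    and \<gamma> \<beta>pl \<beta>op :: real
  assumes "0 \<le> \<gamma>" and "\<gamma> < 1"
  shows "(\<exists>!V :: 's \<Rightarrow> real. bellman_pl R T \<gamma> \<beta>pl \<beta>op V = V) \<and>
         (\<exists>!V :: 's \<Rightarrow> real. bellman_op R T \<gamma> \<beta>pl \<beta>op V = V) \<and>
         (0 \<le> \<beta>pl \<or> 0 \<le> \<beta>op \<longrightarrow> bellman_pl R T \<gamma> \<beta>pl \<beta>op = bellman_op R T \<gamma> \<beta>pl \<beta>op)"
proof (intro conjI impI)
  \<comment> \<open>A sup distance \<open>e\<close> between free energy vectors becomes at most
    \<open>\<gamma> * e\<close> between action values; payoffs and both extrema preserve that bound,
    whatever the signs of the parameters.\<close>
  show "\<exists>!V. bellman_pl R T \<gamma> \<beta>pl \<beta>op V = V"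
    unfolding bellman_pl_eq_extremum[abs_def]
    by (intro sup_contraction_unique_fixed_point[OF assms] extremum_extremum_dist
        continuous_on_payoff payoff_dist action_value_dist assms)
  show "\<exists>!V. bellman_op R T \<gamma> \<beta>pl \<beta>op V = V"
    unfolding bellman_op_eq_extremum[abs_def]
    by (intro sup_contraction_unique_fixed_point[OF assms] extremum_extremum_dist
        continuous_on_swap_args[OF continuous_on_payoff] payoff_dist action_value_dist assms)
  show "bellman_pl R T \<gamma> \<beta>pl \<beta>op = bellman_op R T \<gamma> \<beta>pl \<beta>op" if "0 \<le> \<beta>pl \<or> 0 \<le> \<beta>op"
    by (simp add: fun_eq_iff bellman_pl_eq_extremum bellman_op_eq_extremum
        extremum_payoff_swap[OF that])
qed

end
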